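(* Consider a piecewise linear system $$\dot x=A(t,\sigma)\,x,\qquad x\in\mathbb{R}^n,$$ where $\sigma(t):[0,+\infty)\to\Sigma$ is a switching signal and $\Sigma$ is a finite index set. If the matrices $A(t,\sigma)$ are bounded and measurable for any $\sigma$ and there exist some matrix measure $\mu$ and a constant $c$ such that $$\mu\left(A(t,\sigma)\right)\le -c,\qquad c>0,\qquad \forall t\in\mathbb{R}^+,\ \forall\sigma\in\Sigma,$$ then all solutions of the system converge asymptotically towards the origin, independently of the switching sequence.
   Context: **Matrix measure.** Given a vector norm $|\cdot|$ on $\mathbb{R}^n$ with induced matrix norm $\|\cdot\|$, the associated matrix measure is $\mu(A):=\lim_{h\searrow 0}\frac1h(\|I+hA\|-1)$. **Switching signal.** $\sigma$ is a piecewise continuous function of time taking finitely many values (so it is piecewise constant); infinitely many switchings in finite time (Zeno behavior) are excluded. **Solutions** are meant in the Caratheodory sense: absolutely continuous functions $x(t)$ with $x(t)=x(t_0)+\int_{t_0}^t A(\tau,\sigma(\tau))x(\tau)\,d\tau$ (Lebesgue integral). *)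

theory Defs
  imports "HOL-Analysis.Analysis"
begin

(* The library's norm on real^'n is the Euclidean one; here an arbitrary norm is
   needed, so norms are functions. *)
definition vector_norm :: "(real^'n \<Rightarrow> real) \<Rightarrow> bool" where
  "vector_norm N \<longleftrightarrow>
     (\<forall>x. N x \<ge> 0) \<and>
     (\<forall>x. N x = 0 \<longleftrightarrow> x = 0) \<and>
     (\<forall>a x. N (a *\<^sub>R x) = \<bar>a\<bar> * N x) \<and>
     (\<forall>x y. N (x + y) \<le> N x + N y)"

definition induced_norm :: "(real^'n \<Rightarrow> real) \<Rightarrow> real^'n^'n \<Rightarrow> real" where
  "induced_norm N A = (SUP x\<in>{x. x \<noteq> 0}. N (A *v x) / N x)"

(* For a vector norm N the limit always exists: the quotient is nondecreasing in h > 0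
   and bounded below by the negative of the induced norm of A. *)
definition matrix_measure :: "(real^'n \<Rightarrow> real) \<Rightarrow> real^'n^'n \<Rightarrow> real" where
  "matrix_measure N A =
     Lim (at_right 0) (\<lambda>h. (1 / h) * (induced_norm N (mat 1 + h *\<^sub>R A) - 1))"

(* D collects the switching times in [0,T]; its finiteness excludes Zeno behaviour.
   The values at the switching times themselves are unrestricted within S. *)
definition switching_signal :: "'s set \<Rightarrow> (real \<Rightarrow> 's) \<Rightarrow> bool" where
  "switching_signal S \<sigma> \<longleftrightarrow>
     (\<forall>t\<ge>0. \<sigma> t \<in> S) \<and>
     (\<forall>T\<ge>0. \<exists>D. finite D \<and>
        (\<forall>a b. 0 \<le> a \<and> a < b \<and> b \<le> T \<and> {a<..<b} \<inter> D = {}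
           \<longrightarrow> \<sigma> constant_on {a<..<b}))"

(* The pairs in P are the endpoints of non-overlapping subintervals of I. *)
definition absolutely_continuous_on :: "real set \<Rightarrow> (real \<Rightarrow> 'a::real_normed_vector) \<Rightarrow> bool" where
  "absolutely_continuous_on I f \<longleftrightarrow>
     (\<forall>\<epsilon>>0. \<exists>\<delta>>0. \<forall>P. finite P \<and>
        (\<forall>(a, b)\<in>P. a \<le> b \<and> {a..b} \<subseteq> I) \<and>
        disjoint_family_on (\<lambda>(a, b). {a<..<b}) P \<and>
        (\<Sum>(a, b)\<in>P. b - a) < \<delta>
        \<longrightarrow> (\<Sum>(a, b)\<in>P. norm (f b - f a)) < \<epsilon>)"

(* On the unbounded interval [t0, oo) absolute continuity is meant on compact subintervals. *)
definition caratheodory_solution ::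
    "(real \<Rightarrow> 's \<Rightarrow> real^'n^'n) \<Rightarrow> (real \<Rightarrow> 's) \<Rightarrow> real \<Rightarrow> (real \<Rightarrow> real^'n) \<Rightarrow> bool" where
  "caratheodory_solution A \<sigma> t\<^sub>0 x \<longleftrightarrow>
     (\<forall>T\<ge>t\<^sub>0. absolutely_continuous_on {t\<^sub>0..T} x) \<and>
     (\<forall>t\<ge>t\<^sub>0. set_integrable lebesgue {t\<^sub>0..t} (\<lambda>\<tau>. A \<tau> (\<sigma> \<tau>) *v x \<tau>) \<and>
        x t = x t\<^sub>0 + (LINT \<tau>:{t\<^sub>0..t}|lebesgue. A \<tau> (\<sigma> \<tau>) *v x \<tau>))"

end

theory Submission
  imports Defs
begin

text \<open>A matrix measure at most \<open>- c\<close> says that the Euler step \<open>I + h A\<close> contracts the norm by a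
  factor of about \<open>1 - c h\<close> when \<open>h\<close> is small. All matrices \<open>A (t, s)\<close> lie in one bounded set,
  since there are finitely many modes and each is bounded; by compactness a single step size \<open>h\<close>
  serves all of them, with rate \<open>c / 2\<close>: this is \<open>uniform_euler_contraction\<close>. Hence the velocity
  \<open>g\<close> of a solution satisfies \<open>N (x t + h g t) \<le> (1 - c h / 2) N (x t)\<close> at every time, whatever
  mode is active; this is why the decay is the same for every switching sequence.

  Heuristically this gives \<open>d/dt N (x t) \<le> - (c / 2) N (x t)\<close>, but a Caratheodory solution has a
  derivative only almost everywhere. The argument therefore stays with the integral equation. The
  identity \<open>g = ((x + h g) - x) / h\<close> turns it, on an interval of length \<open>\<delta> \<le> h\<close>, into a convex
  combination of the initial state and an average of contracted states, up to an error of order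
  \<open>\<delta>\<^sup>2\<close>. So \<open>exp (c t / 2) N (x t)\<close> increases by at most \<open>C \<delta>\<^sup>2\<close> on such an interval, and
  a function with this property is nonincreasing (\<open>nonincreasing_if_quadratic_increments\<close>). The
  resulting exponential decay is \<open>exponential_decay_if_euler_contraction\<close>.\<close>

section \<open>Vector norms and their induced matrix norms\<close>

lemma vector_normD:
  assumes "vector_norm N"
  shows "N x \<ge> 0" "N x = 0 \<longleftrightarrow> x = 0" "N (a *\<^sub>R x) = \<bar>a\<bar> * N x" "N (x + y) \<le> N x + N y"
  using assms unfolding vector_norm_def by blast+

lemma vector_norm_zero: "vector_norm N \<Longrightarrow> N 0 = 0"
  using vector_normD(2) by blast

lemma vector_norm_pos: "vector_norm N \<Longrightarrow> x \<noteq> 0 \<Longrightarrow> 0 < N x"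
  using vector_normD(1,2)[of N x] by linarith

lemma vector_norm_minus: "vector_norm N \<Longrightarrow> N (- x) = N x"
  using vector_normD(3)[of N "-1" x] by simp

lemma vector_norm_diff_le: "vector_norm N \<Longrightarrow> N (x - y) \<le> N x + N y"
  using vector_normD(4)[of N x "- y"] vector_norm_minus[of N y] by simp

lemma convex_on_vector_norm:
  assumes "vector_norm N"
  shows "convex_on UNIV N"
proof (rule convex_onI)
  fix t x y assume "0 < t" "t < (1::real)"
  then show "N ((1 - t) *\<^sub>R x + t *\<^sub>R y) \<le> (1 - t) * N x + t * N y"
    using vector_normD(4)[OF assms, of "(1 - t) *\<^sub>R x" "t *\<^sub>R y"]
    by (simp add: vector_normD(3)[OF assms])
qed simp

lemma continuous_on_vector_norm:
  assumes "vector_norm N"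
  shows "continuous_on S N"
  using convex_on_continuous[OF open_UNIV convex_on_vector_norm[OF assms]]
    continuous_on_subset by blast

text \<open>Both comparisons with the Euclidean norm come from the extreme values of the continuous
  function \<^term>\<open>N\<close> on the compact Euclidean unit sphere.\<close>

lemma vector_norm_equivalent:
  fixes N :: "real^'n \<Rightarrow> real"
  assumes "vector_norm N"
  obtains m M where "m > 0" "M > 0" "\<And>x. m * norm x \<le> N x" "\<And>x. N x \<le> M * norm x"
proof -
  let ?S = "sphere (0 :: real^'n) 1"
  have ne: "?S \<noteq> {}" by simp
  obtain u where u: "u \<in> ?S" "\<And>x. x \<in> ?S \<Longrightarrow> N u \<le> N x"
    using continuous_attains_inf[OF compact_sphere ne continuous_on_vector_norm[OF assms]] by blast
  obtain w where w: "w \<in> ?S" "\<And>x. x \<in> ?S \<Longrightarrow> N x \<le> N w"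
    using continuous_attains_sup[OF compact_sphere ne continuous_on_vector_norm[OF assms]] by blast
  have scale: "N x = norm x * N (x /\<^sub>R norm x)" for x :: "real^'n"
    by (cases "x = 0") (simp_all add: vector_norm_zero[OF assms] vector_normD(3)[OF assms])
  have sph: "x /\<^sub>R norm x \<in> ?S" if "x \<noteq> 0" for x :: "real^'n"
    using that by simp
  show thesis
  proof
    have "u \<noteq> 0" "w \<noteq> 0" using u(1) w(1) by auto
    then show "N u > 0" "N w > 0" by (simp_all add: vector_norm_pos[OF assms])
    show "N u * norm x \<le> N x" for x
      using u(2)[OF sph, of x] scale[of x]
      by (cases "x = 0") (auto simp: vector_norm_zero[OF assms] mult.commute intro: mult_left_mono)
    show "N x \<le> N w * norm x" for x
      using w(2)[OF sph, of x] scale[of x]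
      by (cases "x = 0") (auto simp: vector_norm_zero[OF assms] mult.commute intro: mult_left_mono)
  qed
qed

lemma vector_norm_matrix_vector_bound:
  fixes N :: "real^'n \<Rightarrow> real"
  assumes "vector_norm N"
  obtains k where "k > 0" "\<And>A y. N (A *v y) \<le> k * norm A * N y"
proof -
  obtain m M where mM: "m > 0" "M > 0" "\<And>x. m * norm x \<le> N x" "\<And>x. N x \<le> M * norm x"
    using vector_norm_equivalent[OF assms] by metis
  have "bilinear ((*v) :: real^'n^'n \<Rightarrow> real^'n \<Rightarrow> real^'n)"
    unfolding bilinear_def
    by (auto intro!: linearI simp: matrix_vector_right_distrib
        matrix_vector_mult_add_rdistrib matrix_vector_mult_scaleR scaleR_matrix_vector_assoc)
  then interpret bounded_bilinear "(*v) :: real^'n^'n \<Rightarrow> real^'n \<Rightarrow> real^'n"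
    by (simp add: bilinear_conv_bounded_bilinear)
  obtain K where K: "K > 0" "\<And>(A :: real^'n^'n) y. norm (A *v y) \<le> norm A * norm y * K"
    using pos_bounded by blast
  show thesis
  proof
    show "M * K / m > 0" using K mM by simp
    fix A :: "real^'n^'n" and y
    have "N (A *v y) \<le> M * norm (A *v y)" by (rule mM)
    also have "\<dots> \<le> M * (norm A * norm y * K)" using K(2)[of A y] mM(2) by (intro mult_left_mono) auto
    also have "\<dots> = (M * K * norm A / m) * (m * norm y)" using mM(1) by simp
    also have "\<dots> \<le> (M * K * norm A / m) * N y"
      using mM K(1) by (intro mult_left_mono) auto
    finally show "N (A *v y) \<le> M * K / m * norm A * N y" by (simp add: mult_ac)
  qed
qed

lemma vector_norm_matrix_vector_le_induced_norm:
  assumes "vector_norm N"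
  shows "N (A *v y) \<le> induced_norm N A * N y"
proof (cases "y = 0")
  case False
  obtain k where k: "k > 0" "\<And>A y. N (A *v y) \<le> k * norm A * N y"
    using vector_norm_matrix_vector_bound[OF assms] by blast
  have "N (A *v y) / N y \<le> induced_norm N A"
    unfolding induced_norm_def
  proof (rule cSUP_upper)
    show "bdd_above ((\<lambda>x. N (A *v x) / N x) ` {x. x \<noteq> 0})"
      by (rule bdd_aboveI[of _ "k * norm A"])
         (auto simp: pos_divide_le_eq vector_norm_pos[OF assms] k)
  qed (use False in simp)
  then show ?thesis
    using vector_norm_pos[OF assms False] by (simp add: pos_divide_le_eq)
qed (simp add: vector_norm_zero[OF assms])

lemma induced_norm_le:
  fixes N :: "real^'n \<Rightarrow> real"
  assumes "vector_norm N" and "\<And>y. N (A *v y) \<le> r * N y"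
  shows "induced_norm N A \<le> r"
  unfolding induced_norm_def
proof (rule cSUP_least)
  have "(axis undefined 1 :: real^'n) \<noteq> 0" by (simp add: axis_eq_0_iff)
  then show "{x :: real^'n. x \<noteq> 0} \<noteq> {}" by blast
qed (auto simp: pos_divide_le_eq vector_norm_pos[OF assms(1)] assms(2))

section \<open>The matrix measure and a uniform Euler step\<close>

lemma one_plus_scaled_matrix_vector:
  fixes A :: "real^'n^'n"
  shows "(mat 1 + h *\<^sub>R A) *v y = y + h *\<^sub>R (A *v y)"
  by (simp add: matrix_vector_mult_add_rdistrib scaleR_matrix_vector_assoc)

text \<open>As \<^term>\<open>mat 1 + h *\<^sub>R A\<close> lies on the segment from \<^term>\<open>mat 1\<close> to
  \<^term>\<open>mat 1 + k *\<^sub>R A\<close>, convexity of the norm makes the quotient monotone; it is bounded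
  below, so it converges to its infimum. Only this turns the \<^const>\<open>Lim\<close> of the definition
  into an actual limit.\<close>

lemma matrix_measure_tendsto:
  fixes N :: "real^'n \<Rightarrow> real"
  assumes "vector_norm N"
  shows "((\<lambda>h. (1 / h) * (induced_norm N (mat 1 + h *\<^sub>R A) - 1)) \<longlongrightarrow> matrix_measure N A)
           (at_right 0)"
proof -
  define f where "f h = (1 / h) * (induced_norm N (mat 1 + h *\<^sub>R A) - 1)" for h
  obtain \<kappa> where \<kappa>: "\<kappa> > 0" "\<And>A y. N (A *v y) \<le> \<kappa> * norm A * N y"
    using vector_norm_matrix_vector_bound[OF assms] by blast
  have bound: "N (y + h *\<^sub>R (A *v y)) \<le> (1 + h * f h) * N y" if "h > 0" for h y
    using vector_norm_matrix_vector_le_induced_norm[OF assms, of "mat 1 + h *\<^sub>R A" y] that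
    by (simp add: one_plus_scaled_matrix_vector f_def)
  have f_le: "f h \<le> r" if "h > 0" and "\<And>y. N (y + h *\<^sub>R (A *v y)) \<le> (1 + h * r) * N y" for h r
  proof -
    have "induced_norm N (mat 1 + h *\<^sub>R A) \<le> 1 + h * r"
      by (rule induced_norm_le[OF assms]) (simp add: one_plus_scaled_matrix_vector that)
    then show ?thesis using that(1) by (simp add: f_def field_simps)
  qed
  have mono: "f h \<le> f k" if "0 < h" "h \<le> k" for h k
  proof (rule f_le)
    fix y
    have "y + h *\<^sub>R (A *v y) = (1 - h/k) *\<^sub>R y + (h/k) *\<^sub>R (y + k *\<^sub>R (A *v y))"
      using that by (simp add: algebra_simps)
    then have "N (y + h *\<^sub>R (A *v y)) \<le> (1 - h/k) * N y + (h/k) * N (y + k *\<^sub>R (A *v y))"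
      using vector_normD(4)[OF assms, of "(1 - h/k) *\<^sub>R y" "(h/k) *\<^sub>R (y + k *\<^sub>R (A *v y))"] that
      by (simp add: vector_normD(3)[OF assms])
    also have "\<dots> \<le> (1 - h/k) * N y + (h/k) * ((1 + k * f k) * N y)"
      using that bound[of k y] by (intro add_left_mono mult_left_mono) auto
    also have "\<dots> = (1 + h * f k) * N y"
      using that by (simp add: field_simps)
    finally show "N (y + h *\<^sub>R (A *v y)) \<le> (1 + h * f k) * N y" .
  qed (use that in simp)
  have lower: "- (\<kappa> * norm A) \<le> f h" if "h > 0" for h
  proof -
    define e :: "real^'n" where "e = axis undefined 1"
    have e: "N e > 0" unfolding e_def by (rule vector_norm_pos[OF assms]) (simp add: axis_eq_0_iff)
    have "N e = N ((e + h *\<^sub>R (A *v e)) - h *\<^sub>R (A *v e))" by simp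
    also have "\<dots> \<le> N (e + h *\<^sub>R (A *v e)) + h * N (A *v e)"
      using vector_norm_diff_le[OF assms, of "e + h *\<^sub>R (A *v e)" "h *\<^sub>R (A *v e)"] that
      by (simp add: vector_normD(3)[OF assms])
    also have "\<dots> \<le> (1 + h * f h) * N e + h * (\<kappa> * norm A * N e)"
      using that bound[of h e] \<kappa>(2)[of A e] by (intro add_mono mult_left_mono) auto
    finally have "0 \<le> h * N e * (f h + \<kappa> * norm A)" by (simp add: algebra_simps)
    then have "0 \<le> f h + \<kappa> * norm A"
      using e that by (metis mult_pos_pos not_le zero_le_mult_iff order.asym)
    then show ?thesis by simp
  qed
  have bdd: "bdd_below (f ` {0<..})"
    by (rule bdd_belowI[of _ "- (\<kappa> * norm A)"]) (auto simp: lower)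
  \<comment> \<open>The monotone quotient tends to its infimum as \<open>h\<close> decreases to \<open>0\<close>.\<close>
  define l where "l = Inf (f ` {0<..})"
  have "(f \<longlongrightarrow> l) (at_right 0)"
  proof (rule decreasing_tendsto)
    show "\<forall>\<^sub>F h in at_right 0. l \<le> f h"
      unfolding l_def by (auto simp: eventually_at_right_field intro!: exI[of _ 1] cINF_lower[OF bdd])
  next
    fix z assume "l < z"
    then obtain k where k: "k > 0" "f k < z"
      unfolding l_def using cInf_lessD[of "f ` {0<..}" z] by fastforce
    then show "\<forall>\<^sub>F h in at_right 0. f h < z"
      unfolding eventually_at_right_field
      by (intro exI[of _ k]) (metis le_less_trans less_imp_le mono)
  qed
  moreover from this have "matrix_measure N A = l"
    unfolding matrix_measure_def f_def by (intro tendsto_Lim) auto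
  ultimately show ?thesis by (simp add: f_def[abs_def])
qed

text \<open>The limit defining the matrix measure is uniform on bounded sets of matrices, because the
  quotients are Lipschitz in the matrix with a constant that does not depend on \<^term>\<open>h\<close>: a
  finite net of the set carries the estimate over to the whole set. The price is half of the
  rate.\<close>

lemma uniform_euler_contraction:
  fixes N :: "real^'n \<Rightarrow> real"
  assumes N: "vector_norm N" and "bounded K" and "c > 0"
    and \<mu>: "\<And>B. B \<in> K \<Longrightarrow> matrix_measure N B \<le> - c"
  obtains h where "h > 0" "c / 2 * h \<le> 1"
    "\<And>B y. B \<in> K \<Longrightarrow> N (y + h *\<^sub>R (B *v y)) \<le> (1 - c / 2 * h) * N y"
proof -
  obtain \<kappa> where \<kappa>: "\<kappa> > 0" "\<And>A y. N (A *v y) \<le> \<kappa> * norm A * N y"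
    using vector_norm_matrix_vector_bound[OF N] by blast
  \<comment> \<open>Of the rate \<open>c\<close>, one quarter is lost to the limit at the net points and one quarter to the
    distance from the net, for which \<open>\<kappa> \<epsilon> = c / 4\<close> is chosen.\<close>
  define \<epsilon> where "\<epsilon> = c / (4 * \<kappa>)"
  have \<epsilon>: "\<epsilon> > 0" "\<kappa> * \<epsilon> = c / 4" using \<open>c > 0\<close> \<kappa>(1) by (auto simp: \<epsilon>_def)
  have "compact (closure K)" using \<open>bounded K\<close> by (simp add: compact_closure)
  moreover have "closure K \<subseteq> (\<Union>B\<in>K. ball B \<epsilon>)"
    using \<epsilon>(1) by (fastforce simp: closure_approachable)
  ultimately obtain D where D: "D \<subseteq> K" "finite D" "closure K \<subseteq> (\<Union>B\<in>D. ball B \<epsilon>)"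
    using compactE_image[of "closure K" K "\<lambda>B. ball B \<epsilon>"] by (metis open_ball)
  have "\<forall>\<^sub>F h in at_right 0. \<forall>B\<in>D. (1 / h) * (induced_norm N (mat 1 + h *\<^sub>R B) - 1) < - (3 / 4 * c)"
    using D \<mu> \<open>c > 0\<close>
    by (intro eventually_ball_finite ballI order_tendstoD(2)[OF matrix_measure_tendsto[OF N]]) force+
  moreover have "\<forall>\<^sub>F h in at_right 0. 0 < h \<and> h < 2 / c"
    using eventually_at_right_real[of 0 "2 / c"] \<open>c > 0\<close> by simp
  ultimately have "\<forall>\<^sub>F h in at_right 0. (0 < h \<and> h < 2 / c) \<and>
      (\<forall>B\<in>D. (1 / h) * (induced_norm N (mat 1 + h *\<^sub>R B) - 1) < - (3 / 4 * c))"
    by eventually_elim auto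
  from eventually_happens'[OF trivial_limit_at_right_real this]
  obtain h where h: "0 < h" "h < 2 / c"
    "\<And>B. B \<in> D \<Longrightarrow> (1 / h) * (induced_norm N (mat 1 + h *\<^sub>R B) - 1) < - (3 / 4 * c)"
    by blast
  show thesis
  proof
    show "h > 0" "c / 2 * h \<le> 1" using h(1,2) \<open>c > 0\<close> by (auto simp: field_simps)
    fix B y assume "B \<in> K"
    then obtain B' where B': "B' \<in> D" "dist B' B < \<epsilon>"
      using subsetD[OF D(3) subsetD[OF closure_subset]] by auto
    have ind: "induced_norm N (mat 1 + h *\<^sub>R B') \<le> 1 - 3 / 4 * c * h"
      using h(3)[OF B'(1)] h(1) by (simp add: field_simps)
    have "y + h *\<^sub>R (B *v y) = (mat 1 + h *\<^sub>R B') *v y + h *\<^sub>R ((B - B') *v y)"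
      by (simp add: one_plus_scaled_matrix_vector matrix_vector_mult_diff_rdistrib scaleR_diff_right)
    then have "N (y + h *\<^sub>R (B *v y)) \<le> N ((mat 1 + h *\<^sub>R B') *v y) + h * N ((B - B') *v y)"
      using vector_normD(4)[OF N, of "(mat 1 + h *\<^sub>R B') *v y" "h *\<^sub>R ((B - B') *v y)"] h(1)
      by (simp add: vector_normD(3)[OF N])
    also have "N ((mat 1 + h *\<^sub>R B') *v y) \<le> (1 - 3 / 4 * c * h) * N y"
      using vector_norm_matrix_vector_le_induced_norm[OF N] ind vector_normD(1)[OF N]
      by (meson mult_right_mono order_trans)
    also have "N ((B - B') *v y) \<le> \<kappa> * \<epsilon> * N y"
    proof -
      have "N ((B - B') *v y) \<le> \<kappa> * norm (B - B') * N y" by (rule \<kappa>)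
      also have "\<dots> \<le> \<kappa> * \<epsilon> * N y"
        using B'(2) \<kappa>(1) vector_normD(1)[OF N]
        by (intro mult_right_mono mult_left_mono) (auto simp: dist_norm norm_minus_commute)
      finally show ?thesis .
    qed
    finally show "N (y + h *\<^sub>R (B *v y)) \<le> (1 - c / 2 * h) * N y"
      using h(1) unfolding \<epsilon>(2) by (simp add: algebra_simps)
  qed
qed

section \<open>From Euler steps to exponential decay\<close>

text \<open>An average of vectors in the closed convex set \<open>{y. N y \<le> r}\<close> stays in this set: otherwise
  a hyperplane would separate the average from it, and integrating the corresponding linear
  functional gives a contradiction.\<close>

lemma vector_norm_integral_le:
  fixes N :: "real^'n \<Rightarrow> real"
  assumes N: "vector_norm N" and "a \<le> b" and g: "g integrable_on {a..b}"
    and le: "\<And>t. t \<in> {a..b} \<Longrightarrow> N (g t) \<le> r"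
  shows "N (integral {a..b} g) \<le> (b - a) * r"
proof (rule ccontr)
  assume neg: "\<not> ?thesis"
  then have "a < b"
    using \<open>a \<le> b\<close> by (cases "a = b") (auto simp: vector_norm_zero[OF N])
  define C where "C = {y. N y \<le> (b - a) * r}"
  have "convex C"
  proof (rule convexI)
    fix y z and u v :: real assume yz: "y \<in> C" "z \<in> C" and uv: "0 \<le> u" "0 \<le> v" "u + v = 1"
    have "N (u *\<^sub>R y + v *\<^sub>R z) \<le> u * N y + v * N z"
      using vector_normD(4)[OF N, of "u *\<^sub>R y" "v *\<^sub>R z"] uv by (simp add: vector_normD(3)[OF N])
    also have "\<dots> \<le> (b - a) * r"
      using convex_bound_le[of "N y" "(b - a) * r" "N z" u v] yz uv by (simp add: C_def)
    finally show "u *\<^sub>R y + v *\<^sub>R z \<in> C" by (simp add: C_def)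
  qed
  moreover have "closed C"
    unfolding C_def
    by (intro closed_Collect_le continuous_on_vector_norm[OF N] continuous_on_const)
  moreover have "integral {a..b} g \<notin> C" using neg by (simp add: C_def)
  ultimately obtain p q where pq: "p \<bullet> integral {a..b} g < q" "\<And>y. y \<in> C \<Longrightarrow> q < p \<bullet> y"
    using separating_hyperplane_closed_point[of C "integral {a..b} g"] by auto
  have pw: "q / (b - a) \<le> p \<bullet> g t" if "t \<in> {a..b}" for t
  proof -
    have "(b - a) *\<^sub>R g t \<in> C"
      using le[OF that] \<open>a < b\<close> by (simp add: C_def vector_normD(3)[OF N])
    from pq(2)[OF this] show ?thesis using \<open>a < b\<close> by (simp add: pos_divide_le_eq mult.commute)
  qed
  have "((\<lambda>t. p \<bullet> g t) has_integral p \<bullet> integral {a..b} g) {a..b}"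
    using has_integral_linear[OF integrable_integral[OF g] bounded_linear_inner_right, of p]
    by (simp add: o_def)
  moreover have "((\<lambda>t. q / (b - a)) has_integral q) {a..b}"
    using has_integral_const_real[of "q / (b - a)" a b] \<open>a < b\<close> by simp
  ultimately have "q \<le> p \<bullet> integral {a..b} g"
    by (meson has_integral_le pw)
  then show False using pq(1) by simp
qed

text \<open>Summing the increments over \<open>n\<close> equal steps leaves an error of order \<open>1 / n\<close>. This replaces
  the sign of a derivative, which a Caratheodory solution has only almost everywhere.\<close>

lemma nonincreasing_if_quadratic_increments:
  fixes w :: "real \<Rightarrow> real"
  assumes "a \<le> b" "h > 0"
    and inc: "\<And>s t. a \<le> s \<Longrightarrow> s \<le> t \<Longrightarrow> t \<le> b \<Longrightarrow> t - s \<le> h \<Longrightarrow> w t \<le> w s + C * (t - s)\<^sup>2"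
  shows "w b \<le> w a"
proof -
  have est: "w b \<le> w a + C * (b - a)\<^sup>2 * inverse (real n)" if n: "n > 0" "(b - a) / h \<le> real n" for n :: nat
  proof -
    define d where "d = (b - a) / real n"
    have d: "0 \<le> d" "d \<le> h" "real n * d = b - a"
      using n \<open>a \<le> b\<close> \<open>h > 0\<close> by (auto simp: d_def field_simps)
    have "w (a + real k * d) \<le> w a + real k * (C * d\<^sup>2)" if "k \<le> n" for k
      using that
    proof (induction k)
      case (Suc k)
      have "real (Suc k) * d \<le> real n * d"
        using Suc.prems d(1) by (intro mult_right_mono) auto
      then have "w (a + real (Suc k) * d) \<le> w (a + real k * d) + C * d\<^sup>2"
        using inc[of "a + real k * d" "a + real (Suc k) * d"] d by (simp add: algebra_simps)
      then show ?case using Suc by (simp add: algebra_simps)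
    qed simp
    from this[of n] have "w b \<le> w a + real n * (C * d\<^sup>2)" using d(3) by simp
    also have "real n * (C * d\<^sup>2) = C * (b - a)\<^sup>2 * inverse (real n)"
      using n(1) by (simp add: d_def power2_eq_square field_simps)
    finally show ?thesis .
  qed
  have "(\<lambda>n. w a + C * (b - a)\<^sup>2 * inverse (real n)) \<longlonglongrightarrow> w a + C * (b - a)\<^sup>2 * 0"
    by (intro tendsto_intros LIMSEQ_inverse_real_of_nat[THEN LIMSEQ_imp_Suc])
  moreover have "\<forall>\<^sub>F n in sequentially. w b \<le> w a + C * (b - a)\<^sup>2 * inverse (real n)"
    using eventually_gt_at_top[of 0] eventually_ge_at_top[of "nat \<lceil>(b - a) / h\<rceil>"]
    by eventually_elim (rule est, auto simp: nat_ceiling_le_eq)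
  ultimately show ?thesis
    using tendsto_lowerbound by fastforce
qed

text \<open>Writing \<open>g = ((x + h g) - x) / h\<close>, a step of length \<open>\<delta> \<le> h\<close> reads
  \<open>x (s + \<delta>) = (1 - \<delta> / h) x s + (1 / h) \<integral> ((x + h g) - (x - x s))\<close>. Here \<open>x + h g\<close> is contracted
  by the factor \<open>1 - c h\<close>, and \<open>x - x s\<close> is of order \<open>\<delta>\<close>; so \<open>N x\<close> shrinks by the factor
  \<open>1 - c \<delta>\<close> up to an error of order \<open>\<delta>\<^sup>2\<close>, although \<open>h\<close> is fixed.\<close>

lemma exponential_decay_if_euler_contraction:
  fixes N :: "real^'n \<Rightarrow> real" and x g :: "real \<Rightarrow> real^'n"
  assumes N: "vector_norm N" and "a \<le> b" and h: "h > 0" "c * h \<le> 1" and "c \<ge> 0"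
    and cont: "continuous_on {a..b} x"
    and g: "g integrable_on {a..b}"
    and x: "\<And>t. t \<in> {a..b} \<Longrightarrow> x t = x a + integral {a..t} g"
    and contr: "\<And>t. t \<in> {a..b} \<Longrightarrow> N (x t + h *\<^sub>R g t) \<le> (1 - c * h) * N (x t)"
  shows "exp (c * b) * N (x b) \<le> exp (c * a) * N (x a)"
proof -
  have "compact (N ` (x ` {a..b}))"
    by (intro compact_continuous_image cont continuous_on_vector_norm[OF N] compact_Icc)
  then have "bdd_above (N ` (x ` {a..b}))"
    by (intro bounded_imp_bdd_above compact_imp_bounded)
  then obtain R where "\<forall>v\<in>N ` (x ` {a..b}). v \<le> R"
    unfolding bdd_above_def by blast
  then have R: "N (x t) \<le> R" if "t \<in> {a..b}" for t
    using that by blast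
  have "R \<ge> 0" using R[of a] vector_normD(1)[OF N, of "x a"] \<open>a \<le> b\<close> by simp
  \<comment> \<open>The contraction also bounds the velocity, since \<open>h g\<close> is a difference of two vectors of
    norm at most \<open>R\<close>; this makes \<open>x\<close> Lipschitz with constant \<open>L\<close>.\<close>
  define L where "L = 2 * R / h"
  have "L \<ge> 0" using \<open>R \<ge> 0\<close> h by (simp add: L_def)
  have gL: "N (g t) \<le> L" if t: "t \<in> {a..b}" for t
  proof -
    have "h * N (g t) = N ((x t + h *\<^sub>R g t) - x t)"
      using h(1) by (simp add: vector_normD(3)[OF N])
    also have "\<dots> \<le> N (x t + h *\<^sub>R g t) + N (x t)" by (rule vector_norm_diff_le[OF N])
    also have "\<dots> \<le> (1 - c * h) * N (x t) + N (x t)" using contr[OF t] by simp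
    also have "\<dots> \<le> 2 * N (x t)"
      using vector_normD(1)[OF N, of "x t"] h(1) \<open>c \<ge> 0\<close> by (simp add: algebra_simps)
    also have "\<dots> \<le> 2 * R" using R[OF t] by simp
    finally show ?thesis using h(1) by (simp add: L_def field_simps)
  qed
  have sub: "g integrable_on {s..t}" if "a \<le> s" "t \<le> b" for s t
    using g that integrable_on_subinterval[of g "{a..b}" s t] by auto
  have diff: "x t = x s + integral {s..t} g" if "a \<le> s" "s \<le> t" "t \<le> b" for s t
  proof -
    have "integral {a..s} g + integral {s..t} g = integral {a..t} g"
      by (rule Henstock_Kurzweil_Integration.integral_combine) (use that sub[of a t] in auto)
    moreover have "x t = x a + integral {a..t} g" "x s = x a + integral {a..s} g"
      using that by (auto intro: x)
    ultimately show ?thesis by (metis add.assoc)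
  qed
  have lip: "N (x t - x s) \<le> (t - s) * L" if "a \<le> s" "s \<le> t" "t \<le> b" for s t
    using diff[OF that] vector_norm_integral_le[OF N \<open>s \<le> t\<close> sub[of s t], of L] gL that by simp
  have step: "N (x t) \<le> (1 - c * (t - s)) * N (x s) + 2 * L / h * (t - s)\<^sup>2"
    if st: "a \<le> s" "s \<le> t" "t \<le> b" "t - s \<le> h" for s t
  proof -
    define \<delta> where "\<delta> = t - s"
    have \<delta>: "0 \<le> \<delta>" "\<delta> \<le> h" using st by (auto simp: \<delta>_def)
    \<comment> \<open>The constant term makes \<open>h G = (x + h g) - (x - x s)\<close>; its integral is what the factor
      \<open>1 - \<delta> / h\<close> takes away from \<open>x s\<close>.\<close>
    define G where "G \<tau> = g \<tau> + (1 / h) *\<^sub>R x s" for \<tau>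
    have G_int: "G integrable_on {s..t}"
      unfolding G_def using sub[of s t] st by (intro integrable_add) auto
    have "integral {s..t} G = integral {s..t} g + (\<delta> / h) *\<^sub>R x s"
      unfolding G_def using sub[of s t] st by (subst integral_add) (auto simp: \<delta>_def)
    then have xt: "x t = (1 - \<delta> / h) *\<^sub>R x s + integral {s..t} G"
      using diff[of s t] st by (simp add: algebra_simps)
    define r where "r = (1 / h) * ((1 - c * h) * N (x s) + 2 * (\<delta> * L))"
    have "N (G \<tau>) \<le> r" if \<tau>: "\<tau> \<in> {s..t}" for \<tau>
    proof -
      have \<tau>ab: "\<tau> \<in> {a..b}" using \<tau> st by auto
      have "N (x \<tau> - x s) \<le> (\<tau> - s) * L" using lip[of s \<tau>] \<tau> st by auto
      also have "\<dots> \<le> \<delta> * L" using \<tau> \<open>L \<ge> 0\<close> by (intro mult_right_mono) (auto simp: \<delta>_def)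
      finally have near: "N (x \<tau> - x s) \<le> \<delta> * L" .
      have near2: "N (x \<tau>) \<le> N (x s) + \<delta> * L"
        using vector_normD(4)[OF N, of "x s" "x \<tau> - x s"] near by simp
      have "h *\<^sub>R G \<tau> = (x \<tau> + h *\<^sub>R g \<tau>) - (x \<tau> - x s)"
        using h(1) by (simp add: G_def scaleR_add_right)
      then have "h * N (G \<tau>) \<le> N (x \<tau> + h *\<^sub>R g \<tau>) + N (x \<tau> - x s)"
        using vector_norm_diff_le[OF N, of "x \<tau> + h *\<^sub>R g \<tau>" "x \<tau> - x s"] h(1)
          vector_normD(3)[OF N, of h "G \<tau>"] by simp
      also have "\<dots> \<le> (1 - c * h) * (N (x s) + \<delta> * L) + \<delta> * L"
        using contr[OF \<tau>ab] near mult_left_mono[OF near2, of "1 - c * h"] h(2) by simp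
      also have "\<dots> \<le> (1 - c * h) * N (x s) + 2 * (\<delta> * L)"
        using \<delta>(1) \<open>L \<ge> 0\<close> \<open>c \<ge> 0\<close> h(1) by (simp add: algebra_simps)
      finally show ?thesis using h(1) by (simp add: r_def field_simps)
    qed
    then have "N (integral {s..t} G) \<le> \<delta> * r"
      using vector_norm_integral_le[OF N \<open>s \<le> t\<close> G_int, of r] by (simp add: \<delta>_def)
    moreover have "N ((1 - \<delta> / h) *\<^sub>R x s) = (1 - \<delta> / h) * N (x s)"
      using \<delta> h(1) by (simp add: vector_normD(3)[OF N])
    ultimately have "N (x t) \<le> (1 - \<delta> / h) * N (x s) + \<delta> * r"
      using vector_normD(4)[OF N, of "(1 - \<delta> / h) *\<^sub>R x s" "integral {s..t} G"] xt by simp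
    also have "\<dots> = (1 - c * \<delta>) * N (x s) + 2 * L / h * \<delta>\<^sup>2"
      using h(1) by (simp add: r_def field_simps power2_eq_square)
    finally show ?thesis by (simp add: \<delta>_def)
  qed
  define C where "C = exp (c * b) * (2 * L / h)"
  show ?thesis
  proof (rule nonincreasing_if_quadratic_increments[OF \<open>a \<le> b\<close> h(1), where C = C])
    fix s t assume st: "a \<le> s" "s \<le> t" "t \<le> b" "t - s \<le> h"
    \<comment> \<open>The weight absorbs the contraction because \<open>1 - u \<le> exp (- u)\<close>.\<close>
    have "exp (c * t) * N (x t)
        \<le> exp (c * t) * (1 - c * (t - s)) * N (x s) + exp (c * t) * (2 * L / h * (t - s)\<^sup>2)"
      using mult_left_mono[OF step[OF st], of "exp (c * t)"] by (simp add: algebra_simps)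
    also have "\<dots> \<le> exp (c * s) * N (x s) + C * (t - s)\<^sup>2"
    proof (rule add_mono)
      have "exp (c * t) * (1 - c * (t - s)) \<le> exp (c * t) * exp (- (c * (t - s)))"
        using exp_ge_add_one_self[of "- (c * (t - s))"] by (intro mult_left_mono) auto
      also have "\<dots> = exp (c * s)" by (simp add: algebra_simps flip: exp_add)
      finally show "exp (c * t) * (1 - c * (t - s)) * N (x s) \<le> exp (c * s) * N (x s)"
        by (rule mult_right_mono) (rule vector_normD(1)[OF N])
      have "exp (c * t) \<le> exp (c * b)" using st \<open>c \<ge> 0\<close> by (simp add: mult_left_mono)
      then have "exp (c * t) * (2 * L / h * (t - s)\<^sup>2) \<le> exp (c * b) * (2 * L / h * (t - s)\<^sup>2)"
        using \<open>L \<ge> 0\<close> h(1) by (intro mult_right_mono) auto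
      then show "exp (c * t) * (2 * L / h * (t - s)\<^sup>2) \<le> C * (t - s)\<^sup>2" by (simp add: C_def)
    qed
    finally show "exp (c * t) * N (x t) \<le> exp (c * s) * N (x s) + C * (t - s)\<^sup>2" .
  qed
qed

lemma tendsto_0_if_exponential_decay:
  fixes N :: "real^'n \<Rightarrow> real" and x :: "real \<Rightarrow> real^'n"
  assumes N: "vector_norm N" and "c > 0"
    and decay: "\<And>t. t \<ge> a \<Longrightarrow> exp (c * t) * N (x t) \<le> D"
  shows "(x \<longlongrightarrow> 0) at_top"
proof -
  obtain m M where mM: "m > 0" "M > 0" "\<And>x. m * norm x \<le> N x" "\<And>x. N x \<le> M * norm x"
    using vector_norm_equivalent[OF N] by blast
  have "norm (x t) \<le> D / m * exp (- (c * t))" if "t \<ge> a" for t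
  proof -
    have "m * norm (x t) \<le> N (x t)" by (rule mM)
    also have "\<dots> \<le> D * exp (- (c * t))"
      using decay[OF that] by (simp add: exp_minus field_simps)
    finally show ?thesis using mM(1) by (simp add: field_simps)
  qed
  then have "\<forall>\<^sub>F t in at_top. norm (x t) \<le> D / m * exp (- (c * t))"
    by (rule eventually_at_top_linorderI)
  moreover have "((\<lambda>t. D / m * exp (- (c * t))) \<longlongrightarrow> D / m * 0) at_top"
    using \<open>c > 0\<close>
    by (intro tendsto_mult_left filterlim_compose[OF exp_at_bot]
        filterlim_compose[OF filterlim_uminus_at_bot_at_top]
        filterlim_tendsto_pos_mult_at_top[OF tendsto_const] filterlim_ident)
  ultimately show ?thesis
    by (intro Lim_null_comparison[of x]) auto
qed

section \<open>Switched linear systems\<close>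

theorem corollary6:
  fixes A :: "real \<Rightarrow> 's \<Rightarrow> real^'n^'n" and S :: "'s set"
  assumes "finite S"
    and "\<And>s. s \<in> S \<Longrightarrow> bounded ((\<lambda>t. A t s) ` {0..})"
    and "\<And>s. s \<in> S \<Longrightarrow> (\<lambda>t. A t s) \<in> borel_measurable (lebesgue_on {0..})"
    and "\<exists>N c. vector_norm N \<and> c > 0 \<and>
           (\<forall>t\<ge>0. \<forall>s\<in>S. matrix_measure N (A t s) \<le> - c)"
  shows "\<forall>\<sigma> t\<^sub>0 x. switching_signal S \<sigma> \<and> t\<^sub>0 \<ge> 0 \<and> caratheodory_solution A \<sigma> t\<^sub>0 x
           \<longrightarrow> (x \<longlongrightarrow> 0) at_top"
proof (intro allI impI, elim conjE)
  fix \<sigma> t\<^sub>0 x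
  assume sw: "switching_signal S \<sigma>" and t0: "t\<^sub>0 \<ge> 0" and sol: "caratheodory_solution A \<sigma> t\<^sub>0 x"
  obtain N c where N: "vector_norm N" and c: "c > 0"
    and \<mu>: "\<And>t s. t \<ge> 0 \<Longrightarrow> s \<in> S \<Longrightarrow> matrix_measure N (A t s) \<le> - c"
    using assms(4) by blast
  \<comment> \<open>All values of all modes are collected in one bounded set, so that the step size below depends
    neither on the time nor on the switching.\<close>
  define K where "K = (\<Union>s\<in>S. (\<lambda>t. A t s) ` {0..})"
  have "bounded K" unfolding K_def using assms(1,2) by (intro bounded_UN) auto
  moreover have "matrix_measure N B \<le> - c" if "B \<in> K" for B
    using that \<mu> by (auto simp: K_def)
  ultimately obtain h where h: "h > 0" "c / 2 * h \<le> 1"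
    "\<And>B y. B \<in> K \<Longrightarrow> N (y + h *\<^sub>R (B *v y)) \<le> (1 - c / 2 * h) * N y"
    using uniform_euler_contraction[OF N _ c] by blast
  define g where "g \<tau> = A \<tau> (\<sigma> \<tau>) *v x \<tau>" for \<tau>
  have AK: "A \<tau> (\<sigma> \<tau>) \<in> K" if "\<tau> \<ge> t\<^sub>0" for \<tau>
  proof -
    have "\<sigma> \<tau> \<in> S" using that t0 sw by (simp add: switching_signal_def)
    then show ?thesis using that t0 unfolding K_def by fastforce
  qed
  have g_int: "g integrable_on {t\<^sub>0..t}" and x_eq: "x t = x t\<^sub>0 + integral {t\<^sub>0..t} g"
    if "t \<ge> t\<^sub>0" for t
  proof -
    have "set_integrable lebesgue {t\<^sub>0..t} g" "x t = x t\<^sub>0 + (LINT \<tau>:{t\<^sub>0..t}|lebesgue. g \<tau>)"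
      using sol that unfolding caratheodory_solution_def g_def by blast+
    then show "g integrable_on {t\<^sub>0..t}" "x t = x t\<^sub>0 + integral {t\<^sub>0..t} g"
      using set_lebesgue_integral_eq_integral[of "{t\<^sub>0..t}" g] by auto
  qed
  have "exp (c / 2 * T) * N (x T) \<le> exp (c / 2 * t\<^sub>0) * N (x t\<^sub>0)" if T: "T \<ge> t\<^sub>0" for T
  proof (rule exponential_decay_if_euler_contraction[OF N T h(1,2)])
    have "continuous_on {t\<^sub>0..T} (\<lambda>t. x t\<^sub>0 + integral {t\<^sub>0..t} g)"
      by (intro continuous_intros indefinite_integral_continuous_1 g_int T)
    then show "continuous_on {t\<^sub>0..T} x"
      by (rule continuous_on_eq) (rule x_eq[symmetric], simp)
    show "N (x t + h *\<^sub>R g t) \<le> (1 - c / 2 * h) * N (x t)" if "t \<in> {t\<^sub>0..T}" for t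
      unfolding g_def using that by (intro h(3) AK) simp
  qed (use c in \<open>auto intro: g_int[OF T] x_eq\<close>)
  then show "(x \<longlongrightarrow> 0) at_top"
    by (rule tendsto_0_if_exponential_decay[OF N half_gt_zero[OF c]])
qed

end
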